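(* Let $(q_k)_{k\ge 1}$ be a sequence of positive integers with $q_{k+1}\ge q_k(q_k+1)$ for all $k\ge 1$, let $(\xi_k)_{k\ge1}$ be independent random variables with $\mathsf{P}\{\xi_k=0\}=p_{0k}$, $\mathsf{P}\{\xi_k=1\}=p_{1k}$, $p_{0k},p_{1k}\ge 0$, $p_{0k}+p_{1k}=1$, and let $$\xi=\sum_{k=1}^\infty \frac{(-1)^{k+1}\xi_k}{q_k}.$$ If $D:=\prod_{k=1}^\infty \max\{p_{0k},p_{1k}\}=0$, then $\xi$ has a singularly continuous distribution (with respect to Lebesgue measure) of Cantor type with an anomalously fractal spectrum.
   Context: The spectrum (topological support) $S_\xi$ of the distribution of a real random variable $\xi$ is its minimal closed support, i.e. $S_\xi=\{x\in\mathbb{R}:\ \mathsf{P}\{\xi\in(x-\varepsilon,x+\varepsilon)\}>0\ \ \forall\varepsilon>0\}$. A singularly continuous distribution (no atoms, singular with respect to Lebesgue measure) is of Cantor type if its spectrum has Lebesgue measure zero. The spectrum is anomalously fractal if its Hausdorff dimension is $0$. *)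

theory Defs
  imports "HOL-Probability.Probability"
begin

(* Throughout, \<mu> is a Borel probability measure on the reals, i.e. the law of a random variable. *)

definition spectrum :: "real measure \<Rightarrow> real set" where
  "spectrum \<mu> = {x. \<forall>\<epsilon>>0. emeasure \<mu> {x - \<epsilon><..<x + \<epsilon>} > 0}"

definition singularly_continuous :: "real measure \<Rightarrow> bool" where
  "singularly_continuous \<mu> \<longleftrightarrow>
     (\<forall>x. emeasure \<mu> {x} = 0) \<and>
     (\<exists>N \<in> null_sets lborel. emeasure \<mu> (UNIV - N) = 0)"

definition cantor_type :: "real measure \<Rightarrow> bool" where
  "cantor_type \<mu> \<longleftrightarrow> singularly_continuous \<mu> \<and> spectrum \<mu> \<in> null_sets lborel"

(* diam(U)^s with the conventions diam({})^s = 0 and 0^0 = 1, so that the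
   0-dimensional measure is counting measure (note that 0 powr 0 = 0). *)
definition hausdorff_weight :: "real \<Rightarrow> 'a::metric_space set \<Rightarrow> ennreal" where
  "hausdorff_weight s U =
     (if U = {} then 0 else if s = 0 then 1 else ennreal (diameter U powr s))"

(* Boundedness is required of the covering sets because the value of diameter on
   unbounded sets is unspecified. *)
definition hausdorff_premeasure :: "real \<Rightarrow> real \<Rightarrow> 'a::metric_space set \<Rightarrow> ennreal" where
  "hausdorff_premeasure s \<delta> E =
     (INF U \<in> {U :: nat \<Rightarrow> 'a set. E \<subseteq> (\<Union>i. U i) \<and> (\<forall>i. bounded (U i) \<and> diameter (U i) \<le> \<delta>)}.
        \<Sum>i. hausdorff_weight s (U i))"

(* The premeasure increases as \<delta> decreases, so the supremum is the limit for \<delta> to 0. *)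
definition hausdorff_measure :: "real \<Rightarrow> 'a::metric_space set \<Rightarrow> ennreal" where
  "hausdorff_measure s E = (SUP \<delta> \<in> {0<..}. hausdorff_premeasure s \<delta> E)"

definition hausdorff_dim :: "'a::metric_space set \<Rightarrow> ennreal" where
  "hausdorff_dim E = (INF s \<in> {s :: real. s \<ge> 0 \<and> hausdorff_measure s E = 0}. ennreal s)"

definition anomalously_fractal :: "real set \<Rightarrow> bool" where
  "anomalously_fractal E \<longleftrightarrow> hausdorff_dim E = 0"

end

theory Submission
  imports Defs
begin

text \<open>
  A value of \<open>\<xi>\<close> is a signed subsum of the series of the reciprocals of \<open>q k\<close>, and
  the argument rests on how fast these reciprocals decay. The growth condition gives
  \<open>q (k + 1) \<ge> 2 * q k\<close>, and \<open>q (k + 1) \<ge> 3 * q k\<close> as soon as \<open>q k \<ge> 2\<close>, so the tail of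
  \<open>\<Sum> 1 / q k\<close> behind the index \<open>n\<close> is at most \<open>(3/4) / q n\<close>
  (\<open>limit_near_partial_sum\<close>). The factor is smaller than 1, and this has two consequences.

  First, the term at the first index where two digit sequences differ cannot be compensated
  by the later terms. Hence a real number has at most one expansion
  (\<open>signed_digits_unique\<close>), and the event \<open>\<xi> = x\<close> fixes all digits. By independence its
  probability is at most \<open>\<Prod>k=1..n. max (p0 k) (p1 k)\<close> for every \<open>n\<close>, so it vanishes.

  Second, almost surely \<open>\<xi>\<close> lies within \<open>1 / q n\<close> of one of the at most \<open>2 ^ n\<close>
  partial sums of length \<open>n\<close>. The intervals of this radius around the partial sums form a
  closed set of full measure, which therefore contains the spectrum
  (\<open>spectrum_subset_closed\<close>). Since \<open>q (n + 1) / q n\<close> tends to infinity,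
  \<open>2 ^ n * (1 / q n) powr s\<close> tends to 0 for every \<open>s > 0\<close>. The case \<open>s = 1\<close> shows that the
  intersection of these sets, and with it the spectrum, is a Lebesgue null set; all \<open>s > 0\<close>
  together show that the spectrum has Hausdorff dimension 0.
\<close>

section \<open>The spectrum of a Borel measure\<close>

lemma closed_spectrum:
  assumes [measurable_cong]: "sets \<mu> = sets borel"
  shows "closed (spectrum \<mu>)"
proof -
  have "open (- spectrum \<mu>)"
    unfolding open_dist
  proof
    fix x assume "x \<in> - spectrum \<mu>"
    then obtain e where e: "e > 0" "emeasure \<mu> {x - e<..<x + e} = 0"
      unfolding spectrum_def by auto
    have "y \<notin> spectrum \<mu>" if "dist y x < e" for y
    proof -
      define d where "d = e - dist y x"
      have "{y - d<..<y + d} \<subseteq> {x - e<..<x + e}"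
        by (auto simp: d_def dist_real_def)
      then have "emeasure \<mu> {y - d<..<y + d} \<le> emeasure \<mu> {x - e<..<x + e}"
        by (rule emeasure_mono) (use assms in simp)
      with e have "emeasure \<mu> {y - d<..<y + d} = 0"
        by simp
      moreover have "d > 0"
        using that by (simp add: d_def)
      ultimately show ?thesis
        unfolding spectrum_def by auto
    qed
    with e show "\<exists>e>0. \<forall>y. dist y x < e \<longrightarrow> y \<in> - spectrum \<mu>"
      by auto
  qed
  then show ?thesis
    by (simp add: closed_def)
qed

lemma spectrum_subset_closed:
  assumes sets: "sets \<mu> = sets borel"
    and "closed K" and null: "emeasure \<mu> (- K) = 0"
  shows "spectrum \<mu> \<subseteq> K"
proof (rule ccontr)
  assume "\<not> spectrum \<mu> \<subseteq> K"
  then obtain x where x: "x \<in> spectrum \<mu>" "x \<in> - K" by auto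
  have "open (- K)" using \<open>closed K\<close> by (simp add: closed_def)
  then obtain e where e: "e > 0" "ball x e \<subseteq> - K"
    using x by (meson open_contains_ball)
  have "emeasure \<mu> {x - e<..<x + e} \<le> emeasure \<mu> (- K)"
    using e \<open>open (- K)\<close> by (intro emeasure_mono) (auto simp: ball_eq_greaterThanLessThan sets)
  with x e null show False
    unfolding spectrum_def by auto
qed

section \<open>Sets covered by few small balls\<close>

lemma hausdorff_premeasure_le_card_cover:
  fixes E :: "'a::metric_space set"
  assumes "finite F" and cover: "E \<subseteq> (\<Union>c\<in>F. cball c r)"
    and r: "0 \<le> r" "2 * r \<le> \<delta>" and s: "0 < s"
  shows "hausdorff_premeasure s \<delta> E \<le> ennreal (real (card F) * (2 * r) powr s)"
proof -
  obtain h where h: "bij_betw h {0..<card F} F"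
    using ex_bij_betw_nat_finite[OF \<open>finite F\<close>] by blast
  define U where "U i = (if i < card F then cball (h i) r else {})" for i
  have diam: "diameter (cball c r) \<le> 2 * r" for c :: 'a
  proof -
    have "dist x y \<le> 2 * r" if "x \<in> cball c r" "y \<in> cball c r" for x y
      using that dist_triangle[of x y c] by (simp add: dist_commute)
    then show ?thesis
      using r unfolding diameter_def by (auto intro!: cSUP_least)
  qed
  have "E \<subseteq> (\<Union>i. U i)"
  proof
    fix x assume "x \<in> E"
    with cover obtain c where c: "c \<in> F" "x \<in> cball c r" by auto
    with h obtain i where "i < card F" "h i = c"
      unfolding bij_betw_def by (metis atLeastLessThan_iff imageE)
    with c have "x \<in> U i" by (simp add: U_def)
    then show "x \<in> (\<Union>i. U i)" by blast
  qed
  moreover have "bounded (U i) \<and> diameter (U i) \<le> \<delta>" for i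
    using diam[of "h i"] r by (auto simp: U_def)
  ultimately have "hausdorff_premeasure s \<delta> E \<le> (\<Sum>i. hausdorff_weight s (U i))"
    unfolding hausdorff_premeasure_def by (intro INF_lower) auto
  also have "\<dots> = (\<Sum>i<card F. hausdorff_weight s (U i))"
    by (rule suminf_finite) (auto simp: U_def hausdorff_weight_def)
  also have "\<dots> \<le> (\<Sum>i<card F. ennreal ((2 * r) powr s))"
  proof (rule sum_mono)
    fix i
    have "diameter (U i) \<le> 2 * r"
      using diam[of "h i"] r by (auto simp: U_def)
    moreover have "0 \<le> diameter (U i)"
      by (rule diameter_ge_0) (auto simp: U_def)
    ultimately show "hausdorff_weight s (U i) \<le> ennreal ((2 * r) powr s)"
      using s by (auto simp: hausdorff_weight_def intro!: ennreal_leI powr_mono2)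
  qed
  also have "\<dots> = ennreal (real (card F) * (2 * r) powr s)"
    by (simp add: ennreal_mult' ennreal_of_nat_eq_real_of_nat)
  finally show ?thesis .
qed

text \<open>
  The doubling of the radius in passing to diameters costs the constant factor
  \<open>2 powr s\<close>, which does not affect the limit. That the radii tend to 0 makes the covers
  admissible for every mesh \<open>\<delta>\<close>.
\<close>

lemma hausdorff_measure_eq_0I:
  fixes E :: "'a::metric_space set"
  assumes "\<And>n. finite (F n)" and cover: "\<And>n. E \<subseteq> (\<Union>c\<in>F n. cball c (r n))"
    and r: "\<And>n. 0 \<le> r n" "r \<longlonglongrightarrow> 0" and s: "0 < s"
    and small: "(\<lambda>n. real (card (F n)) * r n powr s) \<longlonglongrightarrow> 0"
  shows "hausdorff_measure s E = 0"
proof -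
  have "hausdorff_premeasure s \<delta> E = 0" if "\<delta> > 0" for \<delta>
  proof -
    have "(\<lambda>n. 2 * r n) \<longlonglongrightarrow> 0"
      using tendsto_mult_right_zero[OF r(2)] .
    then have "eventually (\<lambda>n. 2 * r n < \<delta>) sequentially"
      using that by (rule order_tendstoD)
    then have "eventually (\<lambda>n. hausdorff_premeasure s \<delta> E
        \<le> ennreal (real (card (F n)) * (2 * r n) powr s)) sequentially"
    proof eventually_elim
      case (elim n)
      then show ?case
        using hausdorff_premeasure_le_card_cover[OF assms(1) cover r(1)] s by simp
    qed
    moreover have "(\<lambda>n. ennreal (real (card (F n)) * (2 * r n) powr s)) \<longlonglongrightarrow> ennreal 0"
    proof (rule tendsto_ennrealI)
      have "(\<lambda>n. 2 powr s * (real (card (F n)) * r n powr s)) \<longlonglongrightarrow> 0"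
        using tendsto_mult_right_zero[OF small] .
      then show "(\<lambda>n. real (card (F n)) * (2 * r n) powr s) \<longlonglongrightarrow> 0"
        using r by (simp add: powr_mult mult_ac)
    qed
    ultimately have "hausdorff_premeasure s \<delta> E \<le> ennreal 0"
      by (intro tendsto_lowerbound) auto
    then show ?thesis by simp
  qed
  then show ?thesis
    unfolding hausdorff_measure_def by (simp add: SUP_constant)
qed

lemma null_sets_lborelI_cover:
  fixes E :: "real set"
  assumes "E \<in> sets borel"
    and "\<And>n. finite (F n)" and cover: "\<And>n. E \<subseteq> (\<Union>c\<in>F n. cball c (r n))"
    and r: "\<And>n. 0 \<le> r n"
    and small: "(\<lambda>n. real (card (F n)) * r n) \<longlonglongrightarrow> 0"
  shows "E \<in> null_sets lborel"
proof -
  have "emeasure lborel E \<le> ennreal (2 * (real (card (F n)) * r n))" for n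
  proof -
    have "emeasure lborel E \<le> emeasure lborel (\<Union>c\<in>F n. cball c (r n))"
      using cover assms(2) by (intro emeasure_mono) (auto intro!: sets.finite_UN)
    also have "\<dots> \<le> (\<Sum>c\<in>F n. emeasure lborel (cball c (r n)))"
      using assms(2) by (intro emeasure_subadditive_finite) auto
    also have "\<dots> = (\<Sum>c\<in>F n. ennreal (2 * r n))"
      using r by (intro sum.cong) (auto simp: cball_eq_atLeastAtMost)
    also have "\<dots> = ennreal (2 * (real (card (F n)) * r n))"
      using r by (simp add: ennreal_mult' ennreal_of_nat_eq_real_of_nat mult_ac)
    finally show ?thesis .
  qed
  moreover have "(\<lambda>n. ennreal (2 * (real (card (F n)) * r n))) \<longlonglongrightarrow> ennreal 0"
    using tendsto_mult_right_zero[OF small] by (rule tendsto_ennrealI)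
  ultimately have "emeasure lborel E \<le> ennreal 0"
    by (intro tendsto_lowerbound) auto
  with assms(1) show ?thesis
    by (auto intro!: null_setsI)
qed

lemma hausdorff_dim_eq_0I:
  assumes "\<And>s. s > 0 \<Longrightarrow> hausdorff_measure s E = 0"
  shows "hausdorff_dim E = 0"
proof -
  have "hausdorff_dim E \<le> ennreal s" if "s > 0" for s
    unfolding hausdorff_dim_def using assms[OF that] that by (intro INF_lower) auto
  then have "hausdorff_dim E \<le> ennreal (inverse (real (Suc n)))" for n
    by simp
  moreover have "(\<lambda>n. ennreal (inverse (real (Suc n)))) \<longlonglongrightarrow> ennreal 0"
    by (intro tendsto_ennrealI LIMSEQ_inverse_real_of_nat)
  ultimately have "hausdorff_dim E \<le> ennreal 0"
    by (intro tendsto_lowerbound) auto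
  then show ?thesis by simp
qed

section \<open>Expansions with rapidly growing denominators\<close>

locale rapid_denominators =
  fixes q :: "nat \<Rightarrow> nat"
  assumes pos: "\<And>k. k \<ge> 1 \<Longrightarrow> q k > 0"
    and growth: "\<And>k. k \<ge> 1 \<Longrightarrow> q (k + 1) \<ge> q k * (q k + 1)"
begin

lemma index_le: "k \<ge> 1 \<Longrightarrow> k \<le> q k"
proof (induction k rule: dec_induct)
  case base
  then show ?case using pos[of 1] by simp
next
  case (step k)
  have "Suc k \<le> q k + 1" using step by simp
  also have "\<dots> \<le> q k * (q k + 1)" using pos[of k] step by simp
  also have "\<dots> \<le> q (Suc k)" using growth[of k] step by simp
  finally show ?case .
qed

lemma multiple_le_next:
  assumes "k \<ge> 1"
  shows "(k + 1) * q k \<le> q (k + 1)"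
proof -
  have "(k + 1) * q k \<le> q k * (q k + 1)"
    using index_le[OF assms] by (subst mult.commute) (intro mult_left_mono, auto)
  also have "\<dots> \<le> q (k + 1)" by (rule growth[OF assms])
  finally show ?thesis .
qed

text \<open>
  The subtracted term makes the induction on \<open>m\<close> close: from the index 2 on the denominators
  at least triple, so \<open>1 / q (m + 1) \<le> (1/2) * (1 / q m - 1 / q (m + 1))\<close>. At the index 1 they
  need only double, which is why the sum behind \<open>n\<close> gets the factor \<open>3/4\<close> instead of
  \<open>1/2\<close>.
\<close>

lemma sum_reciprocals_le:
  assumes "n \<ge> 1" "m \<ge> n + 1"
  shows "(\<Sum>k=n+1..m. 1 / real (q k)) \<le> 3 / 4 / real (q n) - 1 / 2 / real (q m)"
  using assms(2)
proof (induction m rule: dec_induct)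
  case base
  have "2 * q n \<le> (n + 1) * q n" using assms by (intro mult_right_mono) auto
  then have "2 * q n \<le> q (n + 1)" using multiple_le_next[of n] assms by linarith
  then have "2 * real (q n) \<le> real (q (n + 1))" by linarith
  then have "1 / real (q (n + 1)) \<le> 1 / (2 * real (q n))"
    using pos[of n] assms by (intro divide_left_mono) (auto intro!: mult_pos_pos pos)
  then show ?case by simp
next
  case (step m)
  have "3 * q m \<le> (m + 1) * q m" using assms step by (intro mult_right_mono) auto
  then have "3 * q m \<le> q (m + 1)" using multiple_le_next[of m] assms step by linarith
  then have "3 * real (q m) \<le> real (q (m + 1))" by linarith
  then have "1 / real (q (m + 1)) \<le> 1 / (3 * real (q m))"
    using pos[of m] assms step by (intro divide_left_mono) (auto intro!: mult_pos_pos pos)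
  then show ?case using step by simp
qed

lemma limit_near_partial_sum:
  fixes d :: "nat \<Rightarrow> real"
  assumes d: "\<And>k. k \<ge> 1 \<Longrightarrow> \<bar>d k\<bar> \<le> 1"
    and lim: "(\<lambda>n. \<Sum>k=1..n. d k / real (q k)) \<longlonglongrightarrow> l"
    and "n \<ge> 1"
  shows "\<bar>l - (\<Sum>k=1..n. d k / real (q k))\<bar> \<le> 3 / 4 / real (q n)"
proof (rule tendsto_upperbound)
  show "(\<lambda>m. \<bar>(\<Sum>k=1..m. d k / real (q k)) - (\<Sum>k=1..n. d k / real (q k))\<bar>)
      \<longlonglongrightarrow> \<bar>l - (\<Sum>k=1..n. d k / real (q k))\<bar>"
    by (intro tendsto_intros lim)
  show "eventually (\<lambda>m. \<bar>(\<Sum>k=1..m. d k / real (q k)) - (\<Sum>k=1..n. d k / real (q k))\<bar>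
      \<le> 3 / 4 / real (q n)) sequentially"
    using eventually_ge_at_top[of "n + 1"]
  proof eventually_elim
    case (elim m)
    have "(\<Sum>k=1..m. d k / real (q k)) = (\<Sum>k=1..n. d k / real (q k)) + (\<Sum>k=n+1..m. d k / real (q k))"
      using elim \<open>n \<ge> 1\<close> sum.ub_add_nat[of 1 n "\<lambda>k. d k / real (q k)" "m - n"] by simp
    then have "\<bar>(\<Sum>k=1..m. d k / real (q k)) - (\<Sum>k=1..n. d k / real (q k))\<bar>
        = \<bar>\<Sum>k=n+1..m. d k / real (q k)\<bar>" by simp
    also have "\<dots> \<le> (\<Sum>k=n+1..m. \<bar>d k / real (q k)\<bar>)" by (rule sum_abs)
    also have "\<dots> \<le> (\<Sum>k=n+1..m. 1 / real (q k))"
      using d by (intro sum_mono) (auto simp: abs_divide intro!: divide_right_mono)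
    also have "\<dots> \<le> 3 / 4 / real (q n) - 1 / 2 / real (q m)"
      using sum_reciprocals_le \<open>n \<ge> 1\<close> elim by blast
    also have "\<dots> \<le> 3 / 4 / real (q n)" by simp
    finally show ?case .
  qed
qed simp

text \<open>
  At the first nonzero term of an expansion of 0 the partial sum is \<open>d n / q n\<close>, whose
  distance to the limit 0 exceeds the bound \<open>(3/4) / q n\<close> on the tail.
\<close>

lemma signed_digits_zero:
  fixes d :: "nat \<Rightarrow> real"
  assumes d: "\<And>k. k \<ge> 1 \<Longrightarrow> d k \<in> {-1, 0, 1}"
    and lim: "(\<lambda>n. \<Sum>k=1..n. d k / real (q k)) \<longlonglongrightarrow> 0"
    and "k \<ge> 1"
  shows "d k = 0"
  using \<open>k \<ge> 1\<close>
proof (induction k rule: less_induct)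
  case (less n)
  have "(\<Sum>k=1..n. d k / real (q k)) = (\<Sum>k\<in>{n}. d k / real (q k))"
    using less by (intro sum.mono_neutral_right) auto
  moreover have "\<bar>d k\<bar> \<le> 1" if "k \<ge> 1" for k
    using d[OF that] by auto
  ultimately have "\<bar>d n / real (q n)\<bar> \<le> 3 / 4 / real (q n)"
    using limit_near_partial_sum[OF _ lim, of n] less.prems by simp
  then have "\<bar>d n\<bar> / real (q n) \<le> (3 / 4) / real (q n)"
    by (simp add: abs_divide)
  moreover have "real (q n) > 0"
    using pos[of n] less.prems by simp
  ultimately have "\<bar>d n\<bar> \<le> 3 / 4"
    by (simp only: divide_le_cancel)
  with d[of n] less.prems show ?case by auto
qed

lemma signed_digits_unique:
  fixes x y :: "nat \<Rightarrow> real"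
  assumes x: "\<And>k. k \<ge> 1 \<Longrightarrow> x k \<in> {0, 1}" and y: "\<And>k. k \<ge> 1 \<Longrightarrow> y k \<in> {0, 1}"
    and lim_x: "(\<lambda>n. \<Sum>k=1..n. (-1) ^ (k + 1) * x k / real (q k)) \<longlonglongrightarrow> l"
    and lim_y: "(\<lambda>n. \<Sum>k=1..n. (-1) ^ (k + 1) * y k / real (q k)) \<longlonglongrightarrow> l"
    and "k \<ge> 1"
  shows "x k = y k"
proof -
  define d where "d k = (-1) ^ (k + 1) * (x k - y k)" for k
  have "(\<lambda>n. (\<Sum>k=1..n. (-1) ^ (k + 1) * x k / real (q k))
      - (\<Sum>k=1..n. (-1) ^ (k + 1) * y k / real (q k))) \<longlonglongrightarrow> l - l"
    by (intro tendsto_diff lim_x lim_y)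
  then have "(\<lambda>n. \<Sum>k=1..n. d k / real (q k)) \<longlonglongrightarrow> 0"
    by (simp add: d_def sum_subtractf[symmetric] diff_divide_distrib[symmetric]
        right_diff_distrib)
  moreover have "d k \<in> {-1, 0, 1}" if "k \<ge> 1" for k
    using x[OF that] y[OF that] by (cases "even k") (auto simp: d_def)
  ultimately have "d k = 0"
    using signed_digits_zero \<open>k \<ge> 1\<close> by blast
  then show ?thesis by (simp add: d_def)
qed

text \<open>
  A digit sequence in \<open>{0, 1}\<close> is determined up to the index \<open>n\<close> by the set of those
  indices whose digit is 1.
\<close>

definition centres :: "nat \<Rightarrow> real set" where
  "centres n = (\<lambda>A. \<Sum>k\<in>A. (-1) ^ (k + 1) / real (q k)) ` Pow {1..n}"

lemma finite_centres: "finite (centres n)"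
  by (simp add: centres_def)

lemma card_centres_le: "card (centres n) \<le> 2 ^ n"
  unfolding centres_def using card_image_le[of "Pow {1..n}"] by (simp add: card_Pow)

lemma limit_in_cover:
  fixes x :: "nat \<Rightarrow> real"
  assumes x: "\<And>k. k \<ge> 1 \<Longrightarrow> x k \<in> {0, 1}"
    and lim: "(\<lambda>n. \<Sum>k=1..n. (-1) ^ (k + 1) * x k / real (q k)) \<longlonglongrightarrow> l"
    and "n \<ge> 1"
  shows "l \<in> (\<Union>c\<in>centres n. cball c (1 / real (q n)))"
proof -
  define c where "c = (\<Sum>k=1..n. (-1) ^ (k + 1) * x k / real (q k))"
  have "c = (\<Sum>k\<in>{k\<in>{1..n}. x k = 1}. (-1) ^ (k + 1) / real (q k))"
    unfolding c_def using x by (intro sum.mono_neutral_cong_right) fastforce+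
  then have "c \<in> centres n"
    unfolding centres_def by (auto intro!: image_eqI)
  have "\<bar>(-1) ^ (k + 1) * x k\<bar> \<le> 1" if "k \<ge> 1" for k
    using x[OF that] by (auto simp: abs_mult power_abs)
  from limit_near_partial_sum[OF this lim \<open>n \<ge> 1\<close>]
  have "\<bar>l - c\<bar> \<le> 3 / 4 / real (q n)"
    by (simp add: c_def)
  also have "\<dots> \<le> 1 / real (q n)"
    by (intro divide_right_mono) auto
  finally have "l \<in> cball c (1 / real (q n))"
    by (simp add: dist_real_def abs_minus_commute)
  with \<open>c \<in> centres n\<close> show ?thesis by blast
qed

text \<open>
  The ratio of consecutive terms is at most \<open>2 * (1 / (n + 1)) powr s\<close>, so the ratio test
  applies whatever the base of the power that competes with \<open>q\<close>.
\<close>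

lemma two_power_reciprocal_powr_tendsto_0:
  assumes s: "s > 0"
  shows "(\<lambda>n. 2 ^ n * (1 / real (q n)) powr s) \<longlonglongrightarrow> 0"
proof -
  let ?a = "\<lambda>n. 2 ^ n * (1 / real (q n)) powr s"
  have "((\<lambda>n. (1 / real (n + 1)) powr s) \<longlongrightarrow> 0 powr s) sequentially"
    using s LIMSEQ_inverse_real_of_nat
    by (intro tendsto_powr') (auto simp: inverse_eq_divide add.commute)
  then have "eventually (\<lambda>n. (1 / real (n + 1)) powr s < 1 / 4) sequentially"
    using s by (intro order_tendstoD) auto
  then obtain N where N: "\<And>n. n \<ge> N \<Longrightarrow> (1 / real (n + 1)) powr s < 1 / 4"
    by (auto simp: eventually_sequentially)
  have "summable ?a"
  proof (rule summable_ratio_test[where c = "1/2" and N = "max N 1"])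
    fix n assume n: "max N 1 \<le> n"
    have "real (n + 1) * real (q n) \<le> real (q (n + 1))"
      unfolding of_nat_mult[symmetric] of_nat_le_iff using multiple_le_next[of n] n by simp
    then have "1 / real (q (n + 1)) \<le> 1 / (real (n + 1) * real (q n))"
      using n pos[of n] by (intro divide_left_mono) (auto intro!: mult_pos_pos pos)
    then have "(1 / real (q (n + 1))) powr s \<le> (1 / real (n + 1) * (1 / real (q n))) powr s"
      using s by (intro powr_mono2) auto
    also have "\<dots> = (1 / real (n + 1)) powr s * (1 / real (q n)) powr s"
      by (rule powr_mult)
    also have "\<dots> \<le> 1 / 4 * (1 / real (q n)) powr s"
      using N[of n] n by (intro mult_right_mono) auto
    finally have "(1 / real (q (n + 1))) powr s \<le> 1 / 4 * (1 / real (q n)) powr s" .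
    then have "2 * 2 ^ n * (1 / real (q (n + 1))) powr s
        \<le> 2 * 2 ^ n * (1 / 4 * (1 / real (q n)) powr s)"
      by (intro mult_left_mono) auto
    then show "norm (?a (Suc n)) \<le> 1 / 2 * norm (?a n)"
      by simp
  qed simp
  then show ?thesis by (rule summable_LIMSEQ_zero)
qed

lemma card_centres_powr_tendsto_0:
  assumes s: "s > 0"
  shows "(\<lambda>n. real (card (centres n)) * (1 / real (q n)) powr s) \<longlonglongrightarrow> 0"
proof (rule tendsto_sandwich[OF _ _ tendsto_const two_power_reciprocal_powr_tendsto_0[OF s]])
  have "real (card (centres n)) \<le> 2 ^ n" for n
    using card_centres_le[of n] of_nat_mono by fastforce
  then show "eventually (\<lambda>n. real (card (centres n)) * (1 / real (q n)) powr s
      \<le> 2 ^ n * (1 / real (q n)) powr s) sequentially"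
    by (intro always_eventually allI mult_right_mono) auto
qed simp

text \<open>
  The denominators are controlled from the index 1 on only, hence the shift by \<open>Suc\<close>.
\<close>

definition limit_cover :: "real set" where
  "limit_cover = (\<Inter>n. \<Union>c\<in>centres (Suc n). cball c (1 / real (q (Suc n))))"

lemma closed_limit_cover: "closed limit_cover"
  unfolding limit_cover_def by (intro closed_INT ballI closed_UN finite_centres closed_cball)

lemma null_sets_limit_cover: "limit_cover \<in> null_sets lborel"
proof (rule null_sets_lborelI_cover)
  show "limit_cover \<subseteq> (\<Union>c\<in>centres (Suc n). cball c (1 / real (q (Suc n))))" for n
    unfolding limit_cover_def by blast
  show "(\<lambda>n. real (card (centres (Suc n))) * (1 / real (q (Suc n)))) \<longlonglongrightarrow> 0"
    using LIMSEQ_Suc[OF card_centres_powr_tendsto_0[of 1]] by simp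
qed (auto simp: finite_centres closed_limit_cover borel_closed)

lemma hausdorff_measure_limit_cover:
  assumes "s > 0" and "E \<subseteq> limit_cover"
  shows "hausdorff_measure s E = 0"
proof (rule hausdorff_measure_eq_0I[OF _ _ _ _ \<open>s > 0\<close>])
  show "E \<subseteq> (\<Union>c\<in>centres (Suc n). cball c (1 / real (q (Suc n))))" for n
    using assms(2) unfolding limit_cover_def by blast
  show "(\<lambda>n. real (card (centres (Suc n))) * (1 / real (q (Suc n))) powr s) \<longlonglongrightarrow> 0"
    using LIMSEQ_Suc[OF card_centres_powr_tendsto_0[OF \<open>s > 0\<close>]] .
  show "(\<lambda>n. 1 / real (q (Suc n))) \<longlonglongrightarrow> 0"
  proof (rule tendsto_sandwich[OF _ _ tendsto_const LIMSEQ_inverse_real_of_nat])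
    show "eventually (\<lambda>n. 1 / real (q (Suc n)) \<le> inverse (real (Suc n))) sequentially"
    proof (intro always_eventually allI)
      fix n
      have "real (Suc n) \<le> real (q (Suc n))"
        using index_le[of "Suc n"] by simp
      then show "1 / real (q (Suc n)) \<le> inverse (real (Suc n))"
        unfolding inverse_eq_divide by (intro divide_left_mono) auto
    qed
  qed simp
qed (auto simp: finite_centres)

end

section \<open>The random series\<close>

lemma (in prob_space) prob_all_digits_le:
  fixes X :: "nat \<Rightarrow> 'a \<Rightarrow> real"
  assumes indep: "indep_vars (\<lambda>_. borel) X I" and "J \<subseteq> I" "finite J"
    and bound: "\<And>k. k \<in> J \<Longrightarrow> prob {\<omega> \<in> space M. X k \<omega> = a k} \<le> b k"
  shows "prob {\<omega> \<in> space M. \<forall>k\<in>J. X k \<omega> = a k} \<le> (\<Prod>k\<in>J. b k)"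
proof (cases "J = {}")
  case False
  have "{\<omega> \<in> space M. \<forall>k\<in>J. X k \<omega> = a k} = (\<Inter>k\<in>J. X k -` {a k} \<inter> space M)"
    using False by auto
  moreover have "prob (\<Inter>k\<in>J. X k -` {a k} \<inter> space M) = (\<Prod>k\<in>J. prob (X k -` {a k} \<inter> space M))"
    using indep_varsD[OF indep False \<open>finite J\<close> \<open>J \<subseteq> I\<close>] by simp
  moreover have "X k -` {a k} \<inter> space M = {\<omega> \<in> space M. X k \<omega> = a k}" for k
    by auto
  ultimately show ?thesis
    using bound by (auto intro!: prod_mono)
qed (simp add: prob_space)

lemma (in prob_space) AE_digit:
  fixes X :: "'a \<Rightarrow> real"
  assumes [measurable]: "X \<in> borel_measurable M"
    and "prob {\<omega> \<in> space M. X \<omega> = 0} + prob {\<omega> \<in> space M. X \<omega> = 1} = 1"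
  shows "AE \<omega> in M. X \<omega> \<in> {0, 1}"
proof -
  have "{\<omega> \<in> space M. X \<omega> \<in> {0, 1}} = {\<omega> \<in> space M. X \<omega> = 0} \<union> {\<omega> \<in> space M. X \<omega> = 1}"
    by auto
  moreover have "prob ({\<omega> \<in> space M. X \<omega> = 0} \<union> {\<omega> \<in> space M. X \<omega> = 1}) = 1"
    using assms by (subst finite_measure_Union) auto
  ultimately show ?thesis
    by (subst prob_Collect_eq_1[symmetric]) auto
qed

theorem corollary1:
  fixes M :: "'w measure"
    and q :: "nat \<Rightarrow> nat"
    and p0 p1 :: "nat \<Rightarrow> real"
    and X :: "nat \<Rightarrow> 'w \<Rightarrow> real"
    and \<xi> :: "'w \<Rightarrow> real"
  assumes "prob_space M"
    and "\<And>k. k \<ge> 1 \<Longrightarrow> q k > 0"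
    and "\<And>k. k \<ge> 1 \<Longrightarrow> q (k + 1) \<ge> q k * (q k + 1)"
    and "prob_space.indep_vars M (\<lambda>_. borel) X {1..}"
    and "\<And>k. k \<ge> 1 \<Longrightarrow> measure M {\<omega> \<in> space M. X k \<omega> = 0} = p0 k"
    and "\<And>k. k \<ge> 1 \<Longrightarrow> measure M {\<omega> \<in> space M. X k \<omega> = 1} = p1 k"
    and "\<And>k. k \<ge> 1 \<Longrightarrow> p0 k \<ge> 0 \<and> p1 k \<ge> 0 \<and> p0 k + p1 k = 1"
    and "\<xi> \<in> borel_measurable M"
    and "AE \<omega> in M. (\<lambda>n. \<Sum>k=1..n. (-1) ^ (k + 1) * X k \<omega> / real (q k)) \<longlonglongrightarrow> \<xi> \<omega>"
    and "(\<lambda>n. \<Prod>k=1..n. max (p0 k) (p1 k)) \<longlonglongrightarrow> 0"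
  shows "cantor_type (distr M borel \<xi>) \<and>
         anomalously_fractal (spectrum (distr M borel \<xi>))"
proof -
  interpret prob_space M by fact
  interpret rapid_denominators q using assms(2,3) by unfold_locales
  let ?\<mu> = "distr M borel \<xi>"
  note [measurable] = assms(8)
  have X[measurable]: "X k \<in> borel_measurable M" if "k \<ge> 1" for k
    using assms(4) that unfolding indep_vars_def by auto
  define good where "good \<omega> \<longleftrightarrow> (\<forall>k\<ge>1. X k \<omega> \<in> {0, 1}) \<and>
      (\<lambda>n. \<Sum>k=1..n. (-1) ^ (k + 1) * X k \<omega> / real (q k)) \<longlonglongrightarrow> \<xi> \<omega>" for \<omega>
  have "AE \<omega> in M. k \<ge> 1 \<longrightarrow> X k \<omega> \<in> {0, 1}" for k
    using AE_digit[of "X k"] X[of k] assms(5,6,7)[of k] by (cases "k \<ge> 1") auto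
  then have good: "AE \<omega> in M. good \<omega>"
    unfolding good_def using assms(9) by (simp only: AE_conj_iff AE_all_countable simp_thms)

  have no_atom: "emeasure ?\<mu> {x} = 0" for x
  proof (cases "\<exists>\<omega>. good \<omega> \<and> \<xi> \<omega> = x")
    case False
    have "AE \<omega> in M. \<xi> \<omega> \<notin> {x}"
      using good by eventually_elim (use False in auto)
    then have "emeasure M (\<xi> -` {x} \<inter> space M) = 0"
      by (subst (asm) AE_iff_measurable[where N = "\<xi> -` {x} \<inter> space M"]) auto
    then show ?thesis
      by (simp add: emeasure_distr)
  next
    case True
    \<comment> \<open>The digits of any one sample point over \<open>x\<close> are, by uniqueness, those of all good ones.\<close>
    then obtain \<omega>0 where \<omega>0: "good \<omega>0" "\<xi> \<omega>0 = x" by blast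
    have "prob (\<xi> -` {x} \<inter> space M) \<le> (\<Prod>k=1..n. max (p0 k) (p1 k))" for n
    proof -
      have "AE \<omega> in M. \<omega> \<in> \<xi> -` {x} \<inter> space M
          \<longrightarrow> \<omega> \<in> {\<omega> \<in> space M. \<forall>k\<in>{1..n}. X k \<omega> = X k \<omega>0}"
        using good
      proof eventually_elim
        case (elim \<omega>)
        show ?case
          using elim \<omega>0 signed_digits_unique[of "\<lambda>k. X k \<omega>" "\<lambda>k. X k \<omega>0" x]
          unfolding good_def by auto
      qed
      moreover have "{\<omega> \<in> space M. \<forall>k\<in>{1..n}. X k \<omega> = X k \<omega>0} \<in> events"
        by (intro sets.sets_Collect_finite_All) auto
      ultimately have "prob (\<xi> -` {x} \<inter> space M)
          \<le> prob {\<omega> \<in> space M. \<forall>k\<in>{1..n}. X k \<omega> = X k \<omega>0}"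
        by (rule finite_measure_mono_AE)
      also have "\<dots> \<le> (\<Prod>k=1..n. max (p0 k) (p1 k))"
      proof (rule prob_all_digits_le[OF assms(4)])
        fix k assume "k \<in> {1..n}"
        then have "k \<ge> 1" by simp
        moreover have "X k \<omega>0 \<in> {0, 1}"
          using \<omega>0 \<open>k \<ge> 1\<close> unfolding good_def by blast
        ultimately show "prob {\<omega> \<in> space M. X k \<omega> = X k \<omega>0} \<le> max (p0 k) (p1 k)"
          using assms(5,6)[of k] by auto
      qed auto
      finally show ?thesis .
    qed
    then have "prob (\<xi> -` {x} \<inter> space M) \<le> 0"
      by (intro tendsto_lowerbound[OF assms(10)]) auto
    then show ?thesis
      by (simp add: emeasure_distr emeasure_eq_measure measure_le_0_iff)
  qed

  have full: "emeasure ?\<mu> (- limit_cover) = 0"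
  proof -
    have "AE \<omega> in M. \<xi> \<omega> \<in> limit_cover"
      using good
    proof eventually_elim
      case (elim \<omega>)
      then show ?case
        using limit_in_cover[of "\<lambda>k. X k \<omega>" "\<xi> \<omega>" "Suc n" for n]
        unfolding good_def limit_cover_def by auto
    qed
    then have "AE x in ?\<mu>. x \<in> limit_cover"
      by (subst AE_distr_iff) (auto simp: closed_limit_cover borel_closed)
    then show ?thesis
      by (subst (asm) AE_iff_measurable[where N = "- limit_cover"])
        (auto simp: closed_limit_cover borel_closed)
  qed
  have spectrum: "spectrum ?\<mu> \<subseteq> limit_cover"
    using full by (intro spectrum_subset_closed closed_limit_cover) auto

  have "singularly_continuous ?\<mu>"
    unfolding singularly_continuous_def using no_atom null_sets_limit_cover full
    by (auto simp: Compl_eq_Diff_UNIV)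
  \<comment> \<open>\<open>lborel\<close> is not complete, so a subset of a null set must be shown to be Borel as well.\<close>
  moreover have "spectrum ?\<mu> \<in> null_sets lborel"
    using null_sets_subset[OF null_sets_limit_cover _ spectrum] closed_spectrum[of ?\<mu>]
    by (simp add: borel_closed)
  moreover have "hausdorff_dim (spectrum ?\<mu>) = 0"
    using hausdorff_measure_limit_cover spectrum by (intro hausdorff_dim_eq_0I)
  ultimately show ?thesis
    unfolding cantor_type_def anomalously_fractal_def by blast
qed

end
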